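(* Let $T$ be a tree with $\kappa_{\mathrm m}(T)=2$, and suppose that $H=R\cup U$ (disjoint union) is a disconnected graph generalized cospectral with $T$, where $R$ is a tree and $U$ is a connected bipartite unicyclic graph. Let $C=C_{2\ell}$ be the unique cycle of $U$. Then $$\nu(T)-\nu(R)\ge \ell-1\ge2.$$ In particular, $\nu(R)\le\nu(T)-2$.
   Context: All graphs are finite, simple and undirected. For a graph $X$, $A(X)$ is its adjacency matrix, $\phi_X(x)=\det(xI-A(X))$, and $\nu(X)$ is the matching number. Two graphs are generalized cospectral if they have the same adjacency spectrum and their complements have the same adjacency spectrum. An adjacency eigenvalue is main if its eigenspace is not orthogonal to the all-one vector; the main polynomial $M_X(x)$ is the product of $(x-\lambda)$ over the distinct main eigenvalues $\lambda$ of $X$ (it divides $\phi_X$ in $\mathbb Z[x]$). If $\phi_X=\prod_{i=1}^r f_i^{m_i}$ with $f_i$ distinct, monic and irreducible over $\mathbb Q$, the main-factor multiplicity is $\kappa_{\mathrm m}(X):=\sum_{i:\,f_i\mid M_X} m_i$. A connected graph is unicyclic if it contains exactly one cycle. *)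

theory Defs
  imports
    "Graph_Theory.Digraph_Component"
    "Jordan_Normal_Form.Char_Poly"
    "HOL-Computational_Algebra.Computational_Algebra"
    "HOL-Computational_Algebra.Field_as_Ring"
begin

text \<open>
  A finite simple undirected graph is a \<^locale>\<open>pair_graph\<close>: a finite loop-free symmetric
  digraph, in which the edge $uv$ is represented by the two arcs \<open>(u, v)\<close> and \<open>(v, u)\<close>.
\<close>

definition edges :: "'a pair_pre_digraph \<Rightarrow> 'a set set" where
  "edges G = (\<lambda>(u, v). {u, v}) ` parcs G"

definition complement :: "'a pair_pre_digraph \<Rightarrow> 'a pair_pre_digraph" where
  "complement G =
     \<lparr> pverts = pverts G,
       parcs = {(u, v). u \<in> pverts G \<and> v \<in> pverts G \<and> u \<noteq> v \<and> (u, v) \<notin> parcs G} \<rparr>"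

text \<open>A disjoint union when the vertex sets of the two graphs are disjoint.\<close>

definition graph_union ::
  "'a pair_pre_digraph \<Rightarrow> 'a pair_pre_digraph \<Rightarrow> 'a pair_pre_digraph" where
  "graph_union G H = \<lparr> pverts = pverts G \<union> pverts H, parcs = parcs G \<union> parcs H \<rparr>"

text \<open>
  The library's \<^const>\<open>pre_digraph.cycle\<close> is the directed notion and admits the closed walk
  $u, v, u$ along a single edge, so the length is required to be at least 3. A cycle of an
  undirected graph is a subgraph, not a walk: it is represented by its edge set, which identifies
  walks that differ only in starting point or direction. The length of the cycle is the
  cardinality of this set. For the same reason the library's \<^const>\<open>tree\<close> is not used.
\<close>

definition cycles :: "'a pair_pre_digraph \<Rightarrow> 'a set set set" where
  "cycles G = {(\<lambda>(u, v). {u, v}) ` set p | p.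
     pre_digraph.cycle (with_proj G) p \<and> 3 \<le> length p}"

definition connected_graph :: "'a pair_pre_digraph \<Rightarrow> bool" where
  "connected_graph G \<longleftrightarrow> Digraph_Component.connected (with_proj G)"

definition tree_graph :: "'a pair_pre_digraph \<Rightarrow> bool" where
  "tree_graph G \<longleftrightarrow> connected_graph G \<and> cycles G = {}"

definition unicyclic :: "'a pair_pre_digraph \<Rightarrow> bool" where
  "unicyclic G \<longleftrightarrow> connected_graph G \<and> (\<exists>!C. C \<in> cycles G)"

definition bipartite :: "'a pair_pre_digraph \<Rightarrow> bool" where
  "bipartite G \<longleftrightarrow>
     (\<exists>A B. A \<union> B = pverts G \<and> A \<inter> B = {} \<and> parcs G \<subseteq> A \<times> B \<union> B \<times> A)"

definition matching :: "'a pair_pre_digraph \<Rightarrow> 'a set set \<Rightarrow> bool" where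
  "matching G M \<longleftrightarrow> M \<subseteq> edges G \<and> (\<forall>e\<in>M. \<forall>f\<in>M. e \<noteq> f \<longrightarrow> e \<inter> f = {})"

definition matching_number :: "'a pair_pre_digraph \<Rightarrow> nat" where
  "matching_number G = Max {card M | M. matching G M}"

text \<open>
  The matrices of the library are indexed by natural numbers, so the vertices are listed in an
  arbitrary fixed order. Another order conjugates the adjacency matrix by a permutation matrix,
  which affects none of the notions below.
\<close>

definition vertex_list :: "'a pair_pre_digraph \<Rightarrow> 'a list" where
  "vertex_list G = (SOME vs. distinct vs \<and> set vs = pverts G)"

lemma vertex_list:
  assumes "pair_graph G"
  shows "distinct (vertex_list G)" "set (vertex_list G) = pverts G"
    "length (vertex_list G) = card (pverts G)"
proof -
  interpret pair_graph G by (rule assms)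
  have "\<exists>vs. distinct vs \<and> set vs = pverts G"
    using finite_distinct_list[OF pair_finite_verts] by blast
  from someI_ex[OF this] show "distinct (vertex_list G)" "set (vertex_list G) = pverts G"
    unfolding vertex_list_def by blast+
  then show "length (vertex_list G) = card (pverts G)"
    by (metis distinct_card)
qed

definition adj_matrix :: "'a pair_pre_digraph \<Rightarrow> 'b :: comm_ring_1 mat" where
  "adj_matrix G =
     mat (card (pverts G)) (card (pverts G))
       (\<lambda>(i, j). if (vertex_list G ! i, vertex_list G ! j) \<in> parcs G then 1 else 0)"

definition adj_poly :: "'a pair_pre_digraph \<Rightarrow> 'b :: comm_ring_1 poly" where
  "adj_poly G = char_poly (adj_matrix G)"

text \<open>
  Eigenvalues are taken in the complex numbers. They are all real, since the adjacency matrix is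
  real symmetric, and the complex eigenspaces are the complexifications of the real ones.
\<close>

definition adj_spectrum :: "'a pair_pre_digraph \<Rightarrow> complex multiset" where
  "adj_spectrum G = proots (adj_poly G)"

definition generalized_cospectral :: "'a pair_pre_digraph \<Rightarrow> 'b pair_pre_digraph \<Rightarrow> bool" where
  "generalized_cospectral G H \<longleftrightarrow>
     adj_spectrum G = adj_spectrum H \<and>
     adj_spectrum (complement G) = adj_spectrum (complement H)"

definition main_eigenvalue :: "'a pair_pre_digraph \<Rightarrow> complex \<Rightarrow> bool" where
  "main_eigenvalue G k \<longleftrightarrow>
     (\<exists>v. eigenvector (adj_matrix G) v k \<and> v \<bullet> vec (card (pverts G)) (\<lambda>_. 1) \<noteq> 0)"

definition main_poly :: "'a pair_pre_digraph \<Rightarrow> complex poly" where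
  "main_poly G = (\<Prod>k | main_eigenvalue G k. [:- k, 1:])"

text \<open>
  The main polynomial has integer coefficients, so divisibility by a rational polynomial may be
  tested over the complex numbers.
\<close>

definition main_factor_multiplicity :: "'a pair_pre_digraph \<Rightarrow> nat" where
  "main_factor_multiplicity G =
     (\<Sum>f :: rat poly | monic f \<and> irreducible f \<and> f dvd adj_poly G \<and>
        map_poly of_rat f dvd main_poly G. multiplicity f (adj_poly G))"

end

theory Submission
  imports Defs "HOL-Combinatorics.Cycles" "Jordan_Normal_Form.Schur_Decomposition"
begin

text \<open>
  The coefficient of $x^{n-k}$ in the characteristic polynomial is a signed count of the
  permutations of the vertices that move exactly $k$ of them, each along an arc. If no cycle has
  length at most $k$, these permutations are the matchings with $k/2$ edges, all with the same
  sign. Hence a forest $F$ has $0$ as an eigenvalue with multiplicity $n - 2\nu(F)$, and for $U$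
  this multiplicity is at most $n - 2(\ell - 1)$, since $U$ has no cycle of length below $2\ell$
  while $C$ contains a matching with $\ell - 1$ edges. Comparing the multiplicities in
  $\phi_T = \phi_R \phi_U$ gives $\nu(T) \ge \nu(R) + \ell - 1$.

  To exclude $\ell = 2$, let $N(u, w)$ be the number of common neighbours. The spectrum gives the
  number of edges, the trace of $A^3$ and the sum of $N(u, w)^2$, which is the trace of $A^4$; the
  trace of the cube of the adjacency matrix of the complement then gives the sum of $N(u, w)$.
  So generalized cospectral graphs share the sum of $N(u, w)(N(u, w) - 1)$ over $u \ne w$, which
  is zero exactly when there is no $4$-cycle.
\<close>

subsection \<open>Power sums of eigenvalues\<close>

definition mat_trace :: "'b :: comm_ring_1 mat \<Rightarrow> 'b" where
  "mat_trace A = (\<Sum>i<dim_row A. A $$ (i, i))"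

lemma mat_trace_mult_commute:
  assumes "A \<in> carrier_mat n n" "B \<in> carrier_mat n n"
  shows "mat_trace (A * B) = mat_trace (B * A)"
proof -
  have "mat_trace (A * B) = (\<Sum>i<n. \<Sum>j<n. A $$ (i, j) * B $$ (j, i))"
    using assms by (simp add: mat_trace_def scalar_prod_def lessThan_atLeast0)
  also have "\<dots> = (\<Sum>j<n. \<Sum>i<n. B $$ (j, i) * A $$ (i, j))"
    by (subst sum.swap) (simp add: mult.commute)
  also have "\<dots> = mat_trace (B * A)"
    using assms by (simp add: mat_trace_def scalar_prod_def lessThan_atLeast0)
  finally show ?thesis .
qed

lemma mat_trace_similar:
  assumes A: "A \<in> carrier_mat n n" and sim: "similar_mat_wit A B P Q"
  shows "mat_trace A = mat_trace B"
proof -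
  note w = similar_mat_witD2[OF A sim]
  have "mat_trace A = mat_trace (P * B * Q)"
    using w(3) by simp
  also have "\<dots> = mat_trace (Q * (P * B))"
    using w by (intro mat_trace_mult_commute) auto
  also have "Q * (P * B) = Q * P * B"
    using w by (intro assoc_mult_mat[symmetric]) auto
  also have "\<dots> = B"
    using w by simp
  finally show ?thesis .
qed

text \<open>In the sum over \<open>k\<close> for the entry \<open>(i, j)\<close>, a nonzero term
  needs \<open>i \<le> k \<le> j\<close>: none exists below the diagonal, only \<open>k = i\<close>
  on it.\<close>

lemma upper_triangular_mult:
  assumes A: "A \<in> carrier_mat n n" "upper_triangular A"
    and B: "B \<in> carrier_mat n n" "upper_triangular (B :: 'b :: semiring_1 mat)"
  shows "upper_triangular (A * B)"
    and "i < n \<Longrightarrow> (A * B) $$ (i, i) = A $$ (i, i) * B $$ (i, i)"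
proof -
  have zA: "A $$ (i, j) = 0" if "j < i" "i < n" for i j
    using A that by (auto simp: upper_triangular_def)
  have zB: "B $$ (i, j) = 0" if "j < i" "i < n" for i j
    using B that by (auto simp: upper_triangular_def)
  have entry: "(A * B) $$ (i, j) = (\<Sum>k<n. A $$ (i, k) * B $$ (k, j))" if "i < n" "j < n" for i j
    using A B that by (simp add: scalar_prod_def lessThan_atLeast0)
  have zero: "A $$ (i, k) * B $$ (k, j) = 0" if "k < n" "i < n" "j < n" "k < i \<or> j < k" for i j k
    using that zA[of k i] zB[of j k] by auto
  show "upper_triangular (A * B)"
  proof (rule upper_triangularI)
    fix i j assume ij: "j < i" "i < dim_row (A * B)"
    then have "(A * B) $$ (i, j) = (\<Sum>k<n. A $$ (i, k) * B $$ (k, j))"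
      using A by (intro entry) auto
    also have "\<dots> = 0"
      using ij A by (intro sum.neutral ballI zero) auto
    finally show "(A * B) $$ (i, j) = 0" .
  qed
  assume i: "i < n"
  have "(A * B) $$ (i, i) = (\<Sum>k<n. A $$ (i, k) * B $$ (k, i))"
    using i by (intro entry)
  also have "\<dots> = (\<Sum>k\<in>{i}. A $$ (i, k) * B $$ (k, i))"
    using i by (intro sum.mono_neutral_right ballI zero) auto
  finally show "(A * B) $$ (i, i) = A $$ (i, i) * B $$ (i, i)" by simp
qed

lemma upper_triangular_pow:
  assumes A: "A \<in> carrier_mat n n" "upper_triangular (A :: 'b :: comm_semiring_1 mat)"
  shows "upper_triangular (A ^\<^sub>m k) \<and> (\<forall>i<n. (A ^\<^sub>m k) $$ (i, i) = (A $$ (i, i)) ^ k)"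
proof (induction k)
  case 0
  show ?case using A by (auto simp: upper_triangular_def)
next
  case (Suc k)
  have Ak: "A ^\<^sub>m k \<in> carrier_mat n n" using A by simp
  show ?case
    using upper_triangular_mult[OF Ak _ A] Suc by (auto simp: mult.commute)
qed

text \<open>Schur decomposition makes \<open>A\<close> similar to an upper triangular
  \<open>B\<close>. The diagonal of \<open>B\<close> lists the eigenvalues with multiplicity, that
  of \<open>B ^\<^sub>m k\<close> their powers, and similarity preserves the trace.\<close>

lemma mat_trace_pow:
  assumes A: "(A :: complex mat) \<in> carrier_mat n n"
  shows "mat_trace (A ^\<^sub>m k) = (\<Sum>e\<in>#proots (char_poly A). e ^ k)"
proof -
  obtain es where es: "char_poly A = (\<Prod>a\<leftarrow>es. [:- a, 1:])"
    using char_poly_factorized[OF A] by auto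
  obtain B where B: "B \<in> carrier_mat n n" "upper_triangular B" and sim: "similar_mat A B"
    using schur_decomposition_exists[OF A es] by auto
  then obtain P Q where wit: "similar_mat_wit A B P Q" by (auto simp: similar_mat_def)
  have "proots (char_poly A) = proots (\<Prod>a\<leftarrow>diag_mat B. [:- a, 1:])"
    by (simp add: char_poly_similar[OF sim] char_poly_upper_triangular[OF B])
  also have "\<dots> = mset (diag_mat B)"
  proof -
    have "proots (\<Prod>a\<leftarrow>xs. [:- a, 1:]) = mset xs" for xs :: "complex list"
    proof (induction xs)
      case (Cons x xs)
      have "(\<Prod>a\<leftarrow>xs. [:- a, 1:]) \<noteq> 0" by (auto simp: prod_list_zero_iff)
      then have "proots ([:- x, 1:] * (\<Prod>a\<leftarrow>xs. [:- a, 1:])) = proots [:- x, 1:] + mset xs"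
        using Cons by (subst proots_mult) auto
      then show ?case by (simp add: proots_linear_factor)
    qed simp
    then show ?thesis .
  qed
  finally have "(\<Sum>e\<in>#proots (char_poly A). e ^ k) = (\<Sum>i<n. (B $$ (i, i)) ^ k)"
    using B by (simp add: diag_mat_def sum_mset_sum_list interv_sum_list_conv_sum_set_nat
       lessThan_atLeast0 o_def flip: mset_map)
  also have "\<dots> = mat_trace (B ^\<^sub>m k)"
    using upper_triangular_pow[OF B] B by (simp add: mat_trace_def)
  also have "\<dots> = mat_trace (A ^\<^sub>m k)"
    using mat_trace_similar[OF pow_carrier_mat[OF A] similar_mat_wit_pow[OF wit]] by simp
  finally show ?thesis by simp
qed

section \<open>Matrices indexed by a list of vertices, and their traces as sums over
  vertices\<close>

definition list_mat :: "'a list \<Rightarrow> ('a \<Rightarrow> 'a \<Rightarrow> 'b) \<Rightarrow> 'b mat" where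
  "list_mat vs a = mat (length vs) (length vs) (\<lambda>(i, j). a (vs ! i) (vs ! j))"

lemma list_mat_carrier [simp]: "list_mat vs a \<in> carrier_mat (length vs) (length vs)"
  by (simp add: list_mat_def)

lemma sum_nth_distinct:
  "distinct vs \<Longrightarrow> (\<Sum>i<length vs. f (vs ! i)) = (\<Sum>v\<in>set vs. f v)"
  by (rule sum.reindex_bij_betw[OF bij_betw_nth]) auto

lemma list_mat_mult:
  assumes "distinct vs"
  shows "list_mat vs a * list_mat vs b = list_mat vs (\<lambda>u w. \<Sum>v\<in>set vs. a u v * b v w)"
  using sum_nth_distinct[OF assms]
  by (intro eq_matI) (auto simp: list_mat_def scalar_prod_def lessThan_atLeast0)

lemma mat_trace_list_mat: "distinct vs \<Longrightarrow> mat_trace (list_mat vs a) = (\<Sum>v\<in>set vs. a v v)"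
  using sum_nth_distinct[of vs "\<lambda>v. a v v"] by (simp add: mat_trace_def list_mat_def)

lemma power_sum_list_mat:
  fixes a :: "'a \<Rightarrow> 'a \<Rightarrow> complex"
  assumes "distinct vs" "V = set vs"
  shows "size (proots (char_poly (list_mat vs a))) = card V"
    and "(\<Sum>e\<in>#proots (char_poly (list_mat vs a)). e ^ 2) = (\<Sum>u\<in>V. \<Sum>v\<in>V. a u v * a v u)"
    and "(\<Sum>e\<in>#proots (char_poly (list_mat vs a)). e ^ 3) =
      (\<Sum>u\<in>V. \<Sum>w\<in>V. (\<Sum>v\<in>V. a u v * a v w) * a w u)"
    and "(\<Sum>e\<in>#proots (char_poly (list_mat vs a)). e ^ 4) =
      (\<Sum>u\<in>V. \<Sum>w\<in>V. (\<Sum>v\<in>V. a u v * a v w) * (\<Sum>v\<in>V. a w v * a v u))"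
proof -
  let ?A = "list_mat vs a"
  have A: "?A \<in> carrier_mat (length vs) (length vs)" by simp
  \<comment> \<open>The fourth power is grouped as a product of two squares, so that its trace
    involves only entries of the square.\<close>
  have p2: "?A ^\<^sub>m 2 = ?A * ?A" and p3: "?A ^\<^sub>m 3 = ?A * ?A * ?A"
    and p4: "?A ^\<^sub>m 4 = ?A * ?A * (?A * ?A)"
    using A by (simp_all add: numeral_eq_Suc assoc_mult_mat[OF mult_carrier_mat[OF A A] A A])
  note m = mat_trace_pow[OF A, symmetric]
  show "size (proots (char_poly ?A)) = card V"
    using degree_monic_char_poly[OF A] assms by (simp add: size_proots_complex distinct_card)
  show "(\<Sum>e\<in>#proots (char_poly (list_mat vs a)). e ^ 2) = (\<Sum>u\<in>V. \<Sum>v\<in>V. a u v * a v u)"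
    "(\<Sum>e\<in>#proots (char_poly (list_mat vs a)). e ^ 3) =
      (\<Sum>u\<in>V. \<Sum>w\<in>V. (\<Sum>v\<in>V. a u v * a v w) * a w u)"
    "(\<Sum>e\<in>#proots (char_poly (list_mat vs a)). e ^ 4) =
      (\<Sum>u\<in>V. \<Sum>w\<in>V. (\<Sum>v\<in>V. a u v * a v w) * (\<Sum>v\<in>V. a w v * a v u))"
    unfolding m p2 p3 p4 list_mat_mult[OF assms(1)] mat_trace_list_mat[OF assms(1)] assms(2)
    by (rule refl)+
qed

section \<open>The trace of the cube for a complement\<close>

text \<open>With \<open>J\<close> the all-one matrix, the left side is the trace of
  \<open>(J - B)^3\<close>. Rotating the three summation variables cyclically identifies the three
  linear terms, and likewise the three quadratic ones.\<close>

lemma sum_triple_product_one_minus: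
  fixes b :: "'a \<Rightarrow> 'a \<Rightarrow> 'b :: comm_ring_1"
  shows "(\<Sum>u\<in>V. \<Sum>w\<in>V. (\<Sum>v\<in>V. (1 - b u v) * (1 - b v w)) * (1 - b w u)) =
    of_nat (card V) ^ 3 - 3 * of_nat (card V) * (\<Sum>u\<in>V. \<Sum>v\<in>V. b u v) +
    3 * (\<Sum>u\<in>V. \<Sum>w\<in>V. \<Sum>v\<in>V. b u v * b v w) -
    (\<Sum>u\<in>V. \<Sum>w\<in>V. (\<Sum>v\<in>V. b u v * b v w) * b w u)"
proof -
  let ?n = "of_nat (card V) :: 'b"
  let ?S = "\<Sum>u\<in>V. \<Sum>v\<in>V. b u v" and ?W = "\<Sum>u\<in>V. \<Sum>w\<in>V. \<Sum>v\<in>V. b u v * b v w"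
  have x: "(\<Sum>u\<in>V. \<Sum>w\<in>V. \<Sum>v\<in>V. b u v) = ?n * ?S"
    by (simp add: sum_distrib_left)
  have y: "(\<Sum>u\<in>V. \<Sum>w\<in>V. \<Sum>v\<in>V. b v w) = ?n * ?S"
    by (subst (2) sum.swap) simp
  have z: "(\<Sum>u\<in>V. \<Sum>w\<in>V. \<Sum>v\<in>V. b w u) = ?n * ?S"
    by (subst sum.swap) (simp add: sum_distrib_left)
  have yz: "(\<Sum>u\<in>V. \<Sum>w\<in>V. \<Sum>v\<in>V. b v w * b w u) = ?W"
    by (subst sum.swap[of _ V V], subst (2) sum.swap, subst sum.swap, rule sum.cong[OF refl], rule sum.swap)
  have zx: "(\<Sum>u\<in>V. \<Sum>w\<in>V. \<Sum>v\<in>V. b w u * b u v) = ?W"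
    by (subst sum.swap, rule sum.cong[OF refl], subst sum.swap) (rule refl)
  have "(\<Sum>u\<in>V. \<Sum>w\<in>V. (\<Sum>v\<in>V. (1 - b u v) * (1 - b v w)) * (1 - b w u)) =
    (\<Sum>u\<in>V. \<Sum>w\<in>V. \<Sum>v\<in>V. 1 - b u v - b v w - b w u + b u v * b v w + b v w * b w u
      + b w u * b u v - b u v * b v w * b w u)"
    unfolding sum_distrib_right by (intro sum.cong refl) (simp add: algebra_simps)
  also have "\<dots> = ?n ^ 3 - ?n * ?S - ?n * ?S - ?n * ?S + ?W + ?W + ?W
      - (\<Sum>u\<in>V. \<Sum>w\<in>V. \<Sum>v\<in>V. b u v * b v w * b w u)"
    by (simp only: sum.distrib sum_subtractf x y z yz zx) (simp add: power3_eq_cube mult.assoc)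
  finally show ?thesis unfolding sum_distrib_right by simp
qed

text \<open>The adjacency matrix of the complement is \<open>J - (I + A)\<close>, so the preceding
  expansion applies to \<open>B = I + A\<close>. As \<open>A\<close> has zero diagonal, the trace of
  \<open>(I + A)^3\<close> is \<open>n + 3 tr(A^2) + tr(A^3)\<close>.\<close>

lemma sum_triple_product_complement:
  fixes a :: "'a \<Rightarrow> 'a \<Rightarrow> 'b :: comm_ring_1"
  assumes fin: "finite V" and irrefl: "\<And>v. a v v = 0"
    and c: "\<And>u v. u \<in> V \<Longrightarrow> v \<in> V \<Longrightarrow> c u v = (if u = v then 0 else 1 - a u v)"
  defines "n \<equiv> of_nat (card V)"
  shows "(\<Sum>u\<in>V. \<Sum>w\<in>V. (\<Sum>v\<in>V. c u v * c v w) * c w u) =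
    n ^ 3 - 3 * n * (n + (\<Sum>u\<in>V. \<Sum>v\<in>V. a u v)) +
    3 * (n + 2 * (\<Sum>u\<in>V. \<Sum>v\<in>V. a u v) + (\<Sum>u\<in>V. \<Sum>w\<in>V. \<Sum>v\<in>V. a u v * a v w)) -
    (n + 3 * (\<Sum>u\<in>V. \<Sum>v\<in>V. a u v * a v u) +
      (\<Sum>u\<in>V. \<Sum>w\<in>V. (\<Sum>v\<in>V. a u v * a v w) * a w u))"
proof -
  \<comment> \<open>As matrices, \<open>d\<close> is the identity \<open>I\<close>, \<open>b\<close>
    is \<open>I + A\<close>, and \<open>N\<close> is the square of \<open>A\<close>.\<close>
  define d where "d u v = (if u = v then 1 else 0 :: 'b)" for u v :: 'a
  define b where "b u v = d u v + a u v" for u v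
  define N where "N u w = (\<Sum>v\<in>V. a u v * a v w)" for u w
  have d_sum: "(\<Sum>v\<in>V. d u v * f v) = f u" "(\<Sum>v\<in>V. f v * d v u) = f u"
    "(\<Sum>v\<in>V. d v u * f v) = f u" "(\<Sum>v\<in>V. f v * d u v) = f u" "(\<Sum>v\<in>V. d u v) = 1"
    if "u \<in> V" for u f
    using that fin by (simp_all add: d_def if_distrib[of "\<lambda>x. x * _"] if_distrib[of "\<lambda>x. _ * x"] cong: if_cong)
  have cb: "c u v = 1 - b u v" if "u \<in> V" "v \<in> V" for u v
    using that by (simp add: c b_def d_def irrefl)
  have bb: "(\<Sum>v\<in>V. b u v * b v w) = d u w + 2 * a u w + N u w" if "u \<in> V" "w \<in> V" for u w
    using that by (simp add: b_def ring_distribs sum.distrib d_sum N_def) 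
  have s: "(\<Sum>u\<in>V. \<Sum>v\<in>V. b u v) = n + (\<Sum>u\<in>V. \<Sum>v\<in>V. a u v)"
    by (simp add: b_def sum.distrib d_sum n_def)
  have W: "(\<Sum>u\<in>V. \<Sum>w\<in>V. \<Sum>v\<in>V. b u v * b v w) =
    n + 2 * (\<Sum>u\<in>V. \<Sum>v\<in>V. a u v) + (\<Sum>u\<in>V. \<Sum>w\<in>V. N u w)"
  proof -
    have "(\<Sum>u\<in>V. \<Sum>w\<in>V. \<Sum>v\<in>V. b u v * b v w) =
      (\<Sum>u\<in>V. \<Sum>w\<in>V. d u w + 2 * a u w + N u w)"
      by (intro sum.cong refl bb)
    also have "\<dots> = (\<Sum>u\<in>V. \<Sum>w\<in>V. d u w) + 2 * (\<Sum>u\<in>V. \<Sum>v\<in>V. a u v) + (\<Sum>u\<in>V. \<Sum>w\<in>V. N u w)"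
      by (simp only: sum.distrib sum_distrib_left)
    also have "(\<Sum>u\<in>V. \<Sum>w\<in>V. d u w) = n"
      by (simp add: d_sum(5) n_def)
    finally show ?thesis .
  qed
  have t: "(\<Sum>u\<in>V. \<Sum>w\<in>V. (\<Sum>v\<in>V. b u v * b v w) * b w u) =
    n + 3 * (\<Sum>u\<in>V. \<Sum>v\<in>V. a u v * a v u) + (\<Sum>u\<in>V. \<Sum>w\<in>V. N u w * a w u)"
  proof -
    have "(\<Sum>w\<in>V. (\<Sum>v\<in>V. b u v * b v w) * b w u) = 1 + 3 * N u u + (\<Sum>w\<in>V. N u w * a w u)"
      if u: "u \<in> V" for u
    proof -
      have "(\<Sum>w\<in>V. (\<Sum>v\<in>V. b u v * b v w) * b w u) =
        (\<Sum>w\<in>V. (d u w + 2 * a u w + N u w) * d w u) + (\<Sum>w\<in>V. d u w * a w u)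
        + 2 * (\<Sum>w\<in>V. a u w * a w u) + (\<Sum>w\<in>V. N u w * a w u)"
          (is "?l = ?r")
      proof -
        have "?l = (\<Sum>w\<in>V. (d u w + 2 * a u w + N u w) * d w u + d u w * a w u
            + 2 * (a u w * a w u) + N u w * a w u)"
        proof (rule sum.cong[OF refl])
          fix w assume w: "w \<in> V"
          show "(\<Sum>v\<in>V. b u v * b v w) * b w u = (d u w + 2 * a u w + N u w) * d w u + d u w * a w u
            + 2 * (a u w * a w u) + N u w * a w u"
            unfolding bb[OF u w] b_def[of w u] by (simp add: algebra_simps)
        qed
        also have "\<dots> = ?r" by (simp only: sum.distrib sum_distrib_left)
        finally show ?thesis .
      qed
      \<comment> \<open>The summand \<open>0\<close> is the diagonal entry
        \<open>a u u\<close>.\<close>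
      also have "\<dots> = 1 + N u u + 0 + 2 * N u u + (\<Sum>w\<in>V. N u w * a w u)"
        using u by (simp only: d_sum) (simp add: d_def irrefl N_def)
      finally show ?thesis by simp
    qed
    then have "(\<Sum>u\<in>V. \<Sum>w\<in>V. (\<Sum>v\<in>V. b u v * b v w) * b w u) =
        (\<Sum>u\<in>V. 1 + 3 * N u u + (\<Sum>w\<in>V. N u w * a w u))"
      by (rule sum.cong[OF refl])
    also have "\<dots> = (\<Sum>u\<in>V. 1) + 3 * (\<Sum>u\<in>V. N u u) + (\<Sum>u\<in>V. \<Sum>w\<in>V. N u w * a w u)"
      by (simp only: sum.distrib sum_distrib_left)
    finally show ?thesis by (simp add: n_def N_def)
  qed
  have "(\<Sum>u\<in>V. \<Sum>w\<in>V. (\<Sum>v\<in>V. c u v * c v w) * c w u) =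
    (\<Sum>u\<in>V. \<Sum>w\<in>V. (\<Sum>v\<in>V. (1 - b u v) * (1 - b v w)) * (1 - b w u))"
    by (simp add: cb cong: sum.cong)
  then show ?thesis
    unfolding sum_triple_product_one_minus s W t n_def N_def .
qed

subsection \<open>Cycles\<close>

text \<open>In this form the condition on a closed walk says that the targets are the sources
  rotated by one, which is how cycles are handled below.\<close>

lemma pcas_iff: "pcas u p v \<longleftrightarrow> map fst p @ [v] = u # map snd p"
  by (induction p arbitrary: u) auto

lemma pawalk_verts_eq: "pcas u p v \<Longrightarrow> pawalk_verts u p = u # map snd p"
  by (induction p arbitrary: u) auto

text \<open>A cycle is recorded by its list of vertices \<open>ws\<close>, with arcs from each entry
  to the next, cyclically. Distinctness of the targets passes to the sources because one list is a
  rotation of the other.\<close>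

lemma cycles_iff:
  assumes "pair_graph G"
  shows "C \<in> cycles G \<longleftrightarrow> (\<exists>ws. 3 \<le> length ws \<and> distinct ws \<and>
    set (zip ws (rotate1 ws)) \<subseteq> parcs G \<and> C = (\<lambda>(u, v). {u, v}) ` set (zip ws (rotate1 ws)))"
    (is "_ \<longleftrightarrow> ?rhs")
proof -
  interpret pair_graph G by (rule assms)
  have cycle_iff: "cycle p \<longleftrightarrow> (\<exists>u\<in>pverts G. set p \<subseteq> parcs G \<and> pcas u p u \<and> distinct (map snd p) \<and> p \<noteq> [])"
    for p
    unfolding cycle_def awalk_def by (auto simp: pawalk_verts_eq)
  show ?thesis
  proof
    assume "C \<in> cycles G"
    then obtain p where p: "cycle p" "3 \<le> length p" "C = (\<lambda>(u, v). {u, v}) ` set p"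
      unfolding cycles_def by blast
    then obtain u where u: "set p \<subseteq> parcs G" "pcas u p u" "distinct (map snd p)" "p \<noteq> []"
      using cycle_iff by blast
    have eq: "map fst p @ [u] = u # map snd p"
      using u(2) by (simp add: pcas_iff)
    then have rot: "rotate1 (map fst p) = map snd p"
      using u(4) by (cases p) auto
    have "distinct (map fst p)"
      using u(3) unfolding rot[symmetric] by simp
    moreover have "zip (map fst p) (rotate1 (map fst p)) = p"
      unfolding rot by (rule zip_map_fst_snd)
    ultimately show ?rhs
      using p u(1) by (intro exI[of _ "map fst p"]) auto
  next
    assume ?rhs
    then obtain ws where ws: "3 \<le> length ws" "distinct ws" "set (zip ws (rotate1 ws)) \<subseteq> parcs G"
      "C = (\<lambda>(u, v). {u, v}) ` set (zip ws (rotate1 ws))" by blast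
    let ?p = "zip ws (rotate1 ws)"
    have "ws \<noteq> []" using ws(1) by auto
    then have "ws @ [hd ws] = hd ws # rotate1 ws" by (cases ws) auto
    then have "pcas (hd ws) ?p (hd ws)" by (simp add: pcas_iff)
    moreover have "hd ws \<in> pverts G"
    proof -
      have "hd ws \<in> fst ` set ?p"
        using \<open>ws \<noteq> []\<close> by (metis length_rotate1 list.set_map map_fst_zip hd_in_set)
      then obtain e where e: "e \<in> set ?p" "hd ws = fst e" by (rule imageE)
      have "e \<in> parcs G" using e(1) ws(3) by (rule rev_subsetD)
      then show ?thesis unfolding e(2) by (rule arc_fst_in_verts)
    qed
    moreover have "distinct (map snd ?p)"
      using ws(2) by (simp add: map_snd_zip)
    moreover have "?p \<noteq> []"
    proof
      assume "?p = []"
      then have "length ?p = 0" by (simp only: list.size(3))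
      then show False using ws(1) by simp
    qed
    ultimately have "cycle ?p"
      using cycle_iff ws(3) by blast
    then show "C \<in> cycles G"
      using ws(1,4) unfolding cycles_def by (intro CollectI exI[of _ ?p]) auto
  qed
qed

text \<open>The edges at positions \<open>i \<noteq> j\<close> could coincide only if each index
  were the cyclic successor of the other, which forces length 2.\<close>

lemma card_cycle_edges:
  assumes "3 \<le> length ws" "distinct ws"
  shows "card ((\<lambda>(u, v). {u, v}) ` set (zip ws (rotate1 ws))) = length ws"
proof -
  let ?k = "length ws"
  have k: "0 < ?k" using assms(1) by linarith
  let ?e = "\<lambda>i. {ws ! i, ws ! (Suc i mod ?k)}"
  have "set (zip ws (rotate1 ws)) = (\<lambda>i. (ws ! i, ws ! (Suc i mod ?k))) ` {..<?k}"
    by (auto simp: set_zip nth_rotate1)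
  then have "(\<lambda>(u, v). {u, v}) ` set (zip ws (rotate1 ws)) = ?e ` {..<?k}"
    by (simp add: image_image)
  moreover have "inj_on ?e {..<?k}"
  proof (rule inj_onI)
    fix i j assume ij: "i \<in> {..<?k}" "j \<in> {..<?k}" and eq: "?e i = ?e j"
    show "i = j"
    proof (rule ccontr)
      assume "i \<noteq> j"
      moreover have "Suc i mod ?k < ?k" "Suc j mod ?k < ?k"
        using k by simp_all
      ultimately have "Suc i mod ?k = j" "Suc j mod ?k = i"
        using eq ij assms(2) by (auto simp: doubleton_eq_iff nth_eq_iff_index_eq)
      then show False
        using ij assms(1) by (simp add: mod_Suc split: if_splits)
    qed
  qed
  ultimately show ?thesis by (simp add: card_image)
qed

lemma card_cycle_ge_3:
  assumes "pair_graph G" "C \<in> cycles G"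
  shows "card C \<ge> 3"
  using assms by (auto simp: cycles_iff card_cycle_edges)

lemma cycle_of_card_4:
  assumes "pair_graph G" "C \<in> cycles G" "card C = 4"
  obtains u x w y where "u \<noteq> w" "x \<noteq> y"
    "(u, x) \<in> parcs G" "(x, w) \<in> parcs G" "(w, y) \<in> parcs G" "(y, u) \<in> parcs G"
proof -
  obtain ws where ws: "distinct ws" "length ws = 4" "set (zip ws (rotate1 ws)) \<subseteq> parcs G"
    using assms by (auto simp: cycles_iff card_cycle_edges)
  then obtain u x w y where "ws = [u, x, w, y]"
    by (auto simp: numeral_eq_Suc length_Suc_conv)
  with ws show ?thesis by (intro that[of u w x y]) auto
qed

text \<open>The closed walk \<open>u, x, w, y\<close> is a 4-cycle: opposite vertices differ by
  assumption, adjacent ones because there are no loops.\<close>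

lemma cycle_of_two_common_neighbours:
  assumes "pair_graph G" "u \<noteq> w" "x \<noteq> y"
    "(u, x) \<in> parcs G" "(x, w) \<in> parcs G" "(w, y) \<in> parcs G" "(y, u) \<in> parcs G"
  shows "cycles G \<noteq> {}"
proof -
  interpret pair_graph G by (rule assms(1))
  have "distinct [u, x, w, y]"
    using assms(2-) pair_no_loops by force
  moreover have "set (zip [u, x, w, y] (rotate1 [u, x, w, y])) \<subseteq> parcs G"
    using assms(2-) by simp
  ultimately have "\<exists>ws. 3 \<le> length ws \<and> distinct ws \<and> set (zip ws (rotate1 ws)) \<subseteq> parcs G"
    by (intro exI[of _ "[u, x, w, y]"]) simp
  then show ?thesis
    using cycles_iff[OF assms(1)] by blast
qed

text \<open>The orbit of \<open>v\<close> has at least three elements, because neither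
  \<open>p\<close> nor its square fixes \<open>v\<close>. Listed in the order of \<open>p\<close>,
  it is a cycle of \<open>G\<close>, and \<open>p\<close> moves all its vertices.\<close>

lemma cycle_of_permutation_along_arcs:
  assumes G: "pair_graph G" and p: "p permutes pverts G"
    and arcs: "\<And>v. p v \<noteq> v \<Longrightarrow> (v, p v) \<in> parcs G"
    and v: "p (p v) \<noteq> v"
  obtains C where "C \<in> cycles G" "card C \<le> card {x. p x \<noteq> x}"
proof -
  interpret pair_graph G by (rule G)
  have perm: "permutation p"
    using permutes_imp_permutation[OF pair_finite_verts p] .
  \<comment> \<open>\<open>least_power p v\<close> is the length of the orbit, and
    \<open>support p v\<close> lists \<open>v, p v, p (p v), ...\<close> once around.\<close>
  let ?k = "least_power p v" and ?ws = "support p v"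
  have k: "(p ^^ ?k) v = v" "?k > 0"
    using least_power_of_permutation[OF perm] by auto
  have pv: "p v \<noteq> v" using v by auto
  have "?k \<noteq> 1"
  proof
    assume "?k = 1"
    with k(1) pv show False by simp
  qed
  moreover have "?k \<noteq> 2"
  proof
    assume "?k = 2"
    with k(1) v show False by (simp add: numeral_2_eq_2)
  qed
  ultimately have len: "3 \<le> length ?ws"
    using k(2) by simp
  have dist: "distinct ?ws"
    using cycle_of_permutation[OF perm] .
  have inj: "inj p" using p by (rule permutes_inj)
  have nonfixed: "p ((p ^^ i) v) \<noteq> (p ^^ i) v" for i
  proof (induction i)
    case (Suc i)
    then show ?case by (simp add: inj_eq[OF inj])
  qed (simp add: pv)
  have rot: "rotate1 ?ws = map p ?ws"
  proof (rule nth_equalityI)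
    fix i assume "i < length (rotate1 ?ws)"
    then have i: "i < ?k" by simp
    \<comment> \<open>At the last index the rotation wraps around to \<open>v\<close>, which is also
      the value of the \<open>?k\<close>-th power of \<open>p\<close> at \<open>v\<close>.\<close>
    have "(p ^^ (Suc i mod ?k)) v = (p ^^ Suc i) v"
      using k i by (cases "Suc i = ?k") (simp_all del: funpow.simps)
    then show "rotate1 ?ws ! i = map p ?ws ! i"
      using i k(2) by (simp add: nth_rotate1)
  qed simp
  have sub: "set (zip ?ws (rotate1 ?ws)) \<subseteq> parcs G"
    unfolding rot using nonfixed arcs by (auto simp: set_zip)
  define C where "C = (\<lambda>(u, v). {u, v}) ` set (zip ?ws (rotate1 ?ws))"
  have "C \<in> cycles G"
    using cycles_iff[OF G] len dist sub unfolding C_def by blast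
  moreover have "card C \<le> card {x. p x \<noteq> x}"
  proof -
    have "{x. p x \<noteq> x} \<subseteq> pverts G"
      using p by (auto simp: permutes_def)
    then have "finite {x. p x \<noteq> x}"
      using pair_finite_verts finite_subset by blast
    moreover have "set ?ws \<subseteq> {x. p x \<noteq> x}"
      using nonfixed by auto
    ultimately have "card (set ?ws) \<le> card {x. p x \<noteq> x}"
      by (rule card_mono)
    then show ?thesis
      using distinct_card[OF dist] card_cycle_edges[OF len dist] by (simp add: C_def)
  qed
  ultimately show ?thesis by (rule that)
qed

subsection \<open>Coefficients of the characteristic polynomial\<close>

text \<open>Entries are indexed by vertices instead of list positions; the ring stays open because
  integer and complex values both occur.\<close>

definition adj :: "'a pair_pre_digraph \<Rightarrow> 'a \<Rightarrow> 'a \<Rightarrow> 'b :: comm_ring_1" where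
  "adj G u v = (if (u, v) \<in> parcs G then 1 else 0)"

text \<open>This is the Leibniz formula with permutations of indices transported to permutations of
  vertices. The right side depends on \<open>vs\<close> only through its set, so the order of the
  vertices is immaterial.\<close>

lemma char_poly_list_mat:
  fixes a :: "'a \<Rightarrow> 'a \<Rightarrow> 'b :: comm_ring_1"
  assumes vs: "distinct vs" and V: "V = set vs"
  shows "char_poly (list_mat vs a) = (\<Sum>p | p permutes V. of_int (sign p) *
    (\<Prod>v\<in>V. (if p v = v then [:0, 1:] else 0) - [:a v (p v):]))"
proof -
  let ?n = "length vs" and ?f = "\<lambda>i. vs ! i"
  let ?I = "{0..<?n}"
  let ?M = "char_poly_matrix (list_mat vs a)"
  have M: "?M \<in> carrier_mat ?n ?n" by simp
  have bij: "bij_betw ?f ?I V"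
    using vs V by (intro bij_betw_nth) (simp_all add: lessThan_atLeast0)
  then have inj: "inj_on ?f ?I" by (rule bij_betw_imp_inj_on)
  define g where "g = inv_into ?I ?f"
  have bij': "bij_betw g V ?I" unfolding g_def by (rule bij_betw_inv_into[OF bij])
  have fg: "?f (g v) = v" if "v \<in> V" for v
    using that bij unfolding g_def by (metis bij_betw_inv_into_right)
  have gf: "g (?f i) = i" if "i \<in> ?I" for i
    using that bij unfolding g_def by (metis bij_betw_inv_into_left)
  have "char_poly (list_mat vs a) =
    (\<Sum>p | p permutes ?I. of_int (sign p) * (\<Prod>i = 0..<?n. ?M $$ (i, p i)))"
    unfolding char_poly_def by (rule det_def'[OF M])
  also have "\<dots> = (\<Sum>p | p permutes V. of_int (sign p) *
    (\<Prod>v\<in>V. (if p v = v then [:0, 1:] else 0) - [:a v (p v):]))"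
  proof (rule sum.reindex_bij_witness[of _ "map_permutation V g" "map_permutation ?I ?f"])
    fix p assume "p \<in> {p. p permutes ?I}"
    then have p: "p permutes ?I" by simp
    then have pI: "p i \<in> ?I" if "i \<in> ?I" for i using that permutes_in_image by metis
    show "map_permutation V g (map_permutation ?I ?f p) = p"
      using p bij gf by (intro map_permutation_compose_inv) auto
    show "map_permutation ?I ?f p \<in> {p. p permutes V}"
      using map_permutation_permutes[OF bij p] by simp
    have "(\<Prod>v\<in>V. (if map_permutation ?I ?f p v = v then [:0, 1:] else 0) -
        [:a v (map_permutation ?I ?f p v):]) =
      (\<Prod>i\<in>?I. (if map_permutation ?I ?f p (?f i) = ?f i then [:0, 1:] else 0) -
        [:a (?f i) (map_permutation ?I ?f p (?f i)):])"
      by (rule prod.reindex_bij_betw[OF bij, symmetric])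
    also have "\<dots> = (\<Prod>i\<in>?I. ?M $$ (i, p i))"
    proof (rule prod.cong[OF refl])
      fix i assume i: "i \<in> ?I"
      have "(vs ! p i = vs ! i) = (p i = i)"
        using inj_on_eq_iff[OF inj pI[OF i] i] .
      then show "(if map_permutation ?I ?f p (?f i) = ?f i then [:0, 1:] else 0) -
        [:a (?f i) (map_permutation ?I ?f p (?f i)):] = ?M $$ (i, p i)"
        using i pI[OF i] by (auto simp: map_permutation_apply[OF inj] char_poly_matrix_def list_mat_def)
    qed
    finally show "of_int (sign (map_permutation ?I ?f p)) *
      (\<Prod>v\<in>V. (if map_permutation ?I ?f p v = v then [:0, 1:] else 0) -
        [:a v (map_permutation ?I ?f p v):]) = of_int (sign p) * (\<Prod>i = 0..<?n. ?M $$ (i, p i))"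
      using sign_map_permutation[OF inj p] by simp
  next
    fix p assume "p \<in> {p. p permutes V}"
    then have p: "p permutes V" by simp
    show "map_permutation ?I ?f (map_permutation V g p) = p"
      using p bij' fg by (intro map_permutation_compose_inv) auto
    show "map_permutation V g p \<in> {p. p permutes ?I}"
      using map_permutation_permutes[OF bij' p] by simp
  qed
  finally show ?thesis .
qed

text \<open>These are the permutations behind the Harary-Sachs coefficient theorem: their nontrivial
  cycles are single edges and oriented cycles of the graph, covering \<open>k\<close> vertices in
  total.\<close>

definition arc_perms :: "'a pair_pre_digraph \<Rightarrow> nat \<Rightarrow> ('a \<Rightarrow> 'a) set" where
  "arc_perms G k = {p. p permutes pverts G \<and> (\<forall>v. p v \<noteq> v \<longrightarrow> (v, p v) \<in> parcs G) \<and>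
     card {v. p v \<noteq> v} = k}"

text \<open>A fixed vertex contributes \<open>x\<close>, the diagonal entry being zero; a moved one
  contributes \<open>-1\<close> along an arc and \<open>0\<close> otherwise. Moving \<open>k\<close>
  vertices along arcs thus gives \<open>(-1)^k x^(n-k)\<close> times the sign.\<close>

lemma coeff_char_poly_adj:
  assumes G: "pair_graph G" and vs: "distinct vs" "pverts G = set vs" and k: "k \<le> card (pverts G)"
  shows "coeff (char_poly (list_mat vs (adj G))) (card (pverts G) - k) =
    (\<Sum>p\<in>arc_perms G k. of_int (sign p) * (-1) ^ k)"
proof -
  interpret pair_graph G by (rule G)
  let ?V = "pverts G" and ?n = "card (pverts G)"
  let ?F = "\<lambda>p v. (if p v = v then [:0, 1:] else 0) - [:adj G v (p v):]"
  let ?along = "\<lambda>p. \<forall>v. p v \<noteq> v \<longrightarrow> (v, p v) \<in> parcs G"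
  have fin: "finite ?V" by (rule pair_finite_verts)
  have supp: "{v. p v \<noteq> v} \<subseteq> ?V" if "p permutes ?V" for p
    using that by (auto simp: permutes_def)
  have prod: "(\<Prod>v\<in>?V. ?F p v) = (if ?along p then monom ((-1) ^ card {v. p v \<noteq> v}) (?n - card {v. p v \<noteq> v}) else 0)"
    if p: "p permutes ?V" for p
  proof (cases "?along p")
    case True
    let ?S = "{v. p v \<noteq> v}"
    have S: "?S \<subseteq> ?V" by (rule supp[OF p])
    have F: "?F p v = (if v \<in> ?S then [:-1:] else [:0, 1:])" for v
      using True pair_no_loops by (fastforce simp: adj_def)
    have "(\<Prod>v\<in>?V. ?F p v) = (\<Prod>v\<in>?V. if v \<in> ?S then [:-1:] else [:0, 1:])"
      by (rule prod.cong[OF refl F])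
    also have "\<dots> = [:-1:] ^ card ?S * [:0, 1:] ^ card (?V - ?S)"
      using S fin by (subst prod.If_cases) (auto simp: Int_absorb1 Diff_eq)
    also have "\<dots> = monom ((-1) ^ card ?S) (?n - card ?S)"
      using S fin by (simp add: card_Diff_subset finite_subset poly_const_pow monom_altdef)
    finally show ?thesis using True by simp
  next
    case False
    then obtain v where v: "p v \<noteq> v" "(v, p v) \<notin> parcs G" by auto
    then have "v \<in> ?V" using supp[OF p] by auto
    moreover have "?F p v = 0" using v by (simp add: adj_def)
    ultimately have "(\<Prod>v\<in>?V. ?F p v) = 0" using fin by (intro prod_zero bexI[of _ v])
    then show ?thesis by (simp only: False if_False)
  qed
  have "coeff (char_poly (list_mat vs (adj G))) (?n - k) =
    (\<Sum>p | p permutes ?V. coeff (of_int (sign p) * (\<Prod>v\<in>?V. ?F p v)) (?n - k))"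
    by (subst char_poly_list_mat[OF vs]) (simp add: coeff_sum)
  also have "\<dots> = (\<Sum>p | p permutes ?V. if ?along p \<and> card {v. p v \<noteq> v} = k
    then of_int (sign p) * (-1) ^ k else 0)"
  proof (rule sum.cong[OF refl])
    fix p assume "p \<in> {p. p permutes ?V}"
    then have p: "p permutes ?V" by simp
    \<comment> \<open>With both \<open>k\<close> and the number of moved vertices at most
      \<open>?n\<close>, truncated subtraction cannot confuse two exponents.\<close>
    have "card {v. p v \<noteq> v} \<le> ?n"
      using supp[OF p] fin by (rule card_mono[rotated])
    then have "?n - card {v. p v \<noteq> v} = ?n - k \<longleftrightarrow> card {v. p v \<noteq> v} = k"
      using k by auto
    then show "coeff (of_int (sign p) * (\<Prod>v\<in>?V. ?F p v)) (?n - k) =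
      (if ?along p \<and> card {v. p v \<noteq> v} = k then of_int (sign p) * (-1) ^ k else 0)"
      unfolding prod[OF p] by (cases p rule: sign_cases) auto
  qed
  also have "\<dots> = (\<Sum>p\<in>arc_perms G k. of_int (sign p) * (-1) ^ k)"
    unfolding arc_perms_def using finite_permutations[OF fin]
    by (subst sum.inter_filter[symmetric]) (auto intro!: sum.cong)
  finally show ?thesis .
qed

section \<open>Involutions and matchings\<close>

text \<open>An involution is a product of disjoint transpositions. The induction splits off one of
  them, \<open>transpose a b\<close>, which removes two moved points and flips the sign.\<close>

lemma sign_involution:
  assumes "finite S" "p permutes S" "\<And>v. p (p v) = v"
  shows "even (card {v. p v \<noteq> v}) \<and> sign p = (-1) ^ (card {v. p v \<noteq> v} div 2)"
  using assms
proof (induction "card {v. p v \<noteq> v}" arbitrary: p rule: less_induct)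
  case less
  note p = less.prems(2) and inv = less.prems(3)
  have fin: "finite {v. p v \<noteq> v}"
    using less.prems(1) p by (elim finite_subset[rotated]) (auto simp: permutes_def)
  show ?case
  proof (cases "p = id")
    case False
    then obtain a where a: "p a \<noteq> a" by (auto simp: fun_eq_iff)
    define b where "b = p a"
    have b: "b \<noteq> a" "p b = a" using a inv by (auto simp: b_def)
    define q where "q = transpose a b \<circ> p"
    have q: "q v = (if v = a \<or> v = b then v else p v)" for v
      unfolding q_def o_def using inv b by (metis b_def transpose_apply_first transpose_apply_second
          transpose_apply_other)
    have abS: "a \<in> S" "b \<in> S" using p a b by (auto simp: permutes_def)
    have qS: "q permutes S" unfolding q_def using p abS by (intro permutes_compose permutes_swap_id)
    have qinv: "q (q v) = v" for v
      using inv[of v] b by (auto simp: q b_def)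
    have supp: "{v. p v \<noteq> v} = insert a (insert b {v. q v \<noteq> v})"
      using b a by (auto simp: q)
    have "a \<notin> insert b {v. q v \<noteq> v}" "b \<notin> {v. q v \<noteq> v}" using b by (auto simp: q)
    then have card: "card {v. p v \<noteq> v} = Suc (Suc (card {v. q v \<noteq> v}))"
      using fin unfolding supp by simp
    have IH: "even (card {v. q v \<noteq> v}) \<and> sign q = (-1) ^ (card {v. q v \<noteq> v} div 2)"
      using less.hyps[OF _ less.prems(1) qS qinv] card by simp
    have "p = transpose a b \<circ> q" unfolding q_def by (simp add: o_assoc)
    then have "sign p = - sign q"
      using b permutes_imp_permutation[OF less.prems(1) qS]
      by (simp add: sign_compose permutation_swap_id sign_swap_id)
    with IH card show ?thesis by simp
  qed simp
qed

text \<open>The 2-cycles \<open>{v, p v}\<close> are edges; two of them that meet coincide, and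
  together they cover each moved point once.\<close>

lemma matching_of_involution:
  assumes G: "pair_graph G" and p: "p \<in> arc_perms G k" and inv: "\<And>v. p (p v) = v"
  obtains M where "matching G M" "2 * card M = k"
proof -
  interpret pair_graph G by (rule G)
  let ?S = "{v. p v \<noteq> v}"
  define M where "M = (\<lambda>v. {v, p v}) ` ?S"
  have arc: "(v, p v) \<in> parcs G" if "p v \<noteq> v" for v
    using p that by (simp add: arc_perms_def)
  have "?S \<subseteq> pverts G" using p by (auto simp: arc_perms_def permutes_def)
  then have fin: "finite ?S" using pair_finite_verts finite_subset by blast
  have disj: "e \<inter> f = {}" if ef: "e \<in> M" "f \<in> M" "e \<noteq> f" for e f
  proof (rule ccontr)
    assume "e \<inter> f \<noteq> {}"
    moreover obtain v w where vw: "e = {v, p v}" "f = {w, p w}"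
      using ef(1,2) unfolding M_def by blast
    ultimately have "w = v \<or> w = p v \<or> p w = v \<or> p w = p v" by auto
    then have "w = v \<or> w = p v" by (metis inv)
    then have "e = f" using inv[of v] vw by auto
    with ef(3) show False by simp
  qed
  have "M \<subseteq> edges G"
    unfolding M_def edges_def using arc by (auto intro!: rev_image_eqI)
  with disj have "matching G M"
    unfolding matching_def by blast
  moreover have "2 * card M = k"
  proof -
    have "p (p v) \<noteq> p v" if "p v \<noteq> v" for v
      using that by (simp add: inv)
    then have "\<Union>M = ?S" unfolding M_def by blast
    then have "card ?S = (\<Sum>e\<in>M. card e)"
      using disj by (subst card_Union_disjoint[symmetric]) (auto simp: M_def pairwise_def disjnt_def)
    also have "\<dots> = (\<Sum>e\<in>M. 2)"
      by (rule sum.cong) (auto simp: M_def)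
    finally show ?thesis using p by (simp add: arc_perms_def)
  qed
  ultimately show ?thesis by (rule that)
qed

text \<open>The permutation exchanges the ends of every edge of \<open>M\<close> and fixes all other
  vertices.\<close>

lemma involution_of_matching:
  assumes G: "pair_graph G" and M: "matching G M"
  obtains p where "p \<in> arc_perms G (2 * card M)"
proof -
  interpret pair_graph G by (rule G)
  have disj: "e = f" if "e \<in> M" "f \<in> M" "v \<in> e" "v \<in> f" for e f v
    using M that unfolding matching_def by blast
  have edge: "\<exists>u v. e = {u, v} \<and> u \<noteq> v \<and> (u, v) \<in> parcs G \<and> (v, u) \<in> parcs G" if e: "e \<in> M" for e
  proof -
    have "e \<in> edges G" using M e by (auto simp: matching_def)
    then obtain u v where "e = {u, v}" "(u, v) \<in> parcs G" by (auto simp: edges_def)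
    moreover have "(v, u) \<in> parcs G" using calculation pair_sym_arcs by (auto simp: symmetric_conv)
    moreover have "u \<noteq> v" using calculation pair_no_loops by fastforce
    ultimately show ?thesis by blast
  qed
  \<comment> \<open>The partner \<open>w\<close> is unique, because two edges of \<open>M\<close>
    with the common end \<open>v\<close> are equal.\<close>
  define p where "p v = (if v \<in> \<Union>M then (THE w. {v, w} \<in> M) else v)" for v
  have pI: "p v = w" if "{v, w} \<in> M" for v w
  proof -
    have "(THE w. {v, w} \<in> M) = w"
    proof (rule the_equality)
      fix w' assume "{v, w'} \<in> M"
      then have "{v, w'} = {v, w}" using that disj[of _ _ v] by blast
      then show "w' = w" by (auto simp: doubleton_eq_iff)
    qed (rule that)
    moreover have "v \<in> \<Union>M" using that by blast
    ultimately show ?thesis by (simp add: p_def)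
  qed
  have pD: "{v, p v} \<in> M \<and> p v \<noteq> v \<and> (v, p v) \<in> parcs G \<and> p (p v) = v" if v: "v \<in> \<Union>M" for v
  proof -
    obtain e where e: "e \<in> M" "v \<in> e" using v by blast
    then obtain w where w: "e = {v, w}" "v \<noteq> w" "(v, w) \<in> parcs G" using edge[OF e(1)] by auto
    then have "p v = w" using e pI by simp
    moreover have "p w = v" using e w pI[of w v] by (simp add: insert_commute)
    ultimately show ?thesis using e w by auto
  qed
  have fixed: "p v = v" if "v \<notin> \<Union>M" for v using that by (simp add: p_def)
  have supp: "{v. p v \<noteq> v} = \<Union>M" using pD fixed by blast
  have inv: "p (p v) = v" for v using pD fixed by (cases "v \<in> \<Union>M") auto
  have "p permutes pverts G"
  proof -
    have "p v = v" if v: "v \<notin> pverts G" for v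
      using v pD[of v] fixed in_arcsD1 by blast
    moreover have "\<exists>!x. p x = y" for y
      by (metis inv)
    ultimately show ?thesis by (simp add: permutes_def)
  qed
  moreover have "card (\<Union>M) = 2 * card M"
  proof -
    have "card (\<Union>M) = (\<Sum>e\<in>M. card e)"
    proof (rule card_Union_disjoint)
      show "pairwise disjnt M"
        using disj unfolding pairwise_def disjnt_def by blast
      show "finite e" if e: "e \<in> M" for e
        using edge[OF e] by auto
    qed
    also have "\<dots> = (\<Sum>e\<in>M. 2)"
    proof (rule sum.cong[OF refl])
      show "card e = 2" if e: "e \<in> M" for e
        using edge[OF e] by auto
    qed
    finally show ?thesis by simp
  qed
  moreover have "\<forall>v. p v \<noteq> v \<longrightarrow> (v, p v) \<in> parcs G"
    using pD fixed by blast
  ultimately have "p \<in> arc_perms G (2 * card M)"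
    using supp by (simp add: arc_perms_def)
  then show ?thesis by (rule that)
qed

section \<open>The adjacency polynomial and the multiplicity of the eigenvalue 0\<close>

lemma adj_matrix_eq_list_mat:
  "pair_graph G \<Longrightarrow> adj_matrix G = list_mat (vertex_list G) (adj G)"
  by (simp add: adj_matrix_def list_mat_def adj_def[abs_def] vertex_list cong: if_cong)

text \<open>The vertex order may thus be chosen freely; for a disjoint union it will be the
  concatenation of two lists.\<close>

lemma adj_poly_eq_list_mat:
  assumes "pair_graph G" "distinct vs" "set vs = pverts G"
  shows "adj_poly G = char_poly (list_mat vs (adj G))"
  using assms vertex_list[OF assms(1)]
  by (simp add: adj_poly_def adj_matrix_eq_list_mat char_poly_list_mat[where V = "pverts G"])

lemma coeff_adj_poly:
  assumes G: "pair_graph G" and k: "k \<le> card (pverts G)"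
  shows "coeff (adj_poly G :: 'b :: comm_ring_1 poly) (card (pverts G) - k) =
    (\<Sum>p\<in>arc_perms G k. of_int (sign p) * (-1) ^ k)"
  unfolding adj_poly_eq_list_mat[OF G vertex_list(1,2)[OF G]]
  by (rule coeff_char_poly_adj[OF G vertex_list(1)[OF G] vertex_list(2)[OF G, symmetric] k])

lemma matching_number_attained:
  assumes "pair_graph G"
  obtains M where "matching G M" "card M = matching_number G"
    and "\<And>M'. matching G M' \<Longrightarrow> card M' \<le> matching_number G"
proof -
  interpret pair_graph G by (rule assms)
  let ?K = "{card M | M. matching G M}"
  have "finite (edges G)" using pair_finite_arcs by (simp add: edges_def)
  then have "finite (Pow (edges G))" by simp
  then have "finite (card ` Pow (edges G))" by (rule finite_imageI)
  then have fin: "finite ?K"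
    by (rule finite_subset[rotated]) (auto simp: matching_def)
  have "matching G {}" by (simp add: matching_def)
  then have "?K \<noteq> {}" by blast
  then have "Max ?K \<in> ?K" using fin by (intro Max_in)
  then obtain M where "matching G M" "card M = matching_number G"
    unfolding matching_number_def by auto
  moreover have "card M' \<le> matching_number G" if "matching G M'" for M'
    unfolding matching_number_def using that fin by (intro Max_ge) auto
  ultimately show ?thesis by (rule that)
qed

text \<open>A nonzero coefficient of \<open>x^i\<close> needs a permutation along arcs that moves
  \<open>n - i\<close> vertices. Without cycles in \<open>G\<close> it is an involution and yields a
  matching with \<open>(n - i) / 2\<close> edges.\<close>

lemma forest_coeff_nonzero:
  assumes G: "pair_graph G" and acyclic: "cycles G = {}"
    and coeff: "coeff (adj_poly G :: 'b :: comm_ring_1 poly) i \<noteq> 0"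
  shows "card (pverts G) \<le> i + 2 * matching_number G"
proof (cases "i \<le> card (pverts G)")
  case True
  define k where "k = card (pverts G) - i"
  have k: "k \<le> card (pverts G)" "card (pverts G) - k = i" using True by (auto simp: k_def)
  have "(\<Sum>p\<in>arc_perms G k. of_int (sign p) * (-1) ^ k) \<noteq> (0 :: 'b)"
    using coeff unfolding coeff_adj_poly[OF G k(1), unfolded k(2)] .
  then obtain p where p: "p \<in> arc_perms G k"
    by (metis (no_types, lifting) sum.neutral)
  have "p (p v) = v" for v
  proof (rule ccontr)
    assume v: "p (p v) \<noteq> v"
    obtain C where "C \<in> cycles G"
      using cycle_of_permutation_along_arcs[of G p v, OF G _ _ v] p
      unfolding arc_perms_def by blast
    with acyclic show False by simp
  qed
  with matching_of_involution[OF G p] obtain M where "matching G M" "2 * card M = k" by blast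
  with matching_number_attained[OF G] have "k \<le> 2 * matching_number G"
    by (metis mult_le_mono2)
  then show ?thesis by (simp add: k_def)
qed simp

text \<open>Every cycle is too long to fit into \<open>2 * card M\<close> moved vertices, so all
  contributing permutations are involutions of the same sign and cannot cancel. \<open>M\<close>
  supplies one of them, and in characteristic 0 their number stays nonzero in the ring.\<close>

lemma coeff_nonzero_of_matching:
  assumes G: "pair_graph G" and M: "matching G M" and C: "\<And>C. C \<in> cycles G \<Longrightarrow> 2 * card M < card C"
  shows "2 * card M \<le> card (pverts G)"
    and "coeff (adj_poly G :: 'b :: {comm_ring_1, ring_char_0} poly) (card (pverts G) - 2 * card M) \<noteq> 0"
proof -
  interpret pair_graph G by (rule G)
  let ?k = "2 * card M"
  obtain p0 where p0: "p0 \<in> arc_perms G ?k"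
    using involution_of_matching[OF G M] .
  then have "{v. p0 v \<noteq> v} \<subseteq> pverts G" and card_p0: "card {v. p0 v \<noteq> v} = ?k"
    by (auto simp: arc_perms_def permutes_def)
  then show k: "?k \<le> card (pverts G)"
    using card_mono[OF pair_finite_verts] by metis
  have sign: "sign p = (-1) ^ card M" if p: "p \<in> arc_perms G ?k" for p
  proof -
    have P: "p permutes pverts G" "\<And>v. p v \<noteq> v \<Longrightarrow> (v, p v) \<in> parcs G" "card {v. p v \<noteq> v} = ?k"
      using p by (auto simp: arc_perms_def)
    have "p (p v) = v" for v
    proof (rule ccontr)
      assume v: "p (p v) \<noteq> v"
      obtain C' where "C' \<in> cycles G" "card C' \<le> ?k"
        using cycle_of_permutation_along_arcs[OF G P(1,2) v] P(3) by metis
      with C[of C'] show False by simp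
    qed
    then show ?thesis using sign_involution[OF pair_finite_verts P(1)] P(3) by simp
  qed
  have "finite {p. p permutes pverts G}"
    using finite_permutations[OF pair_finite_verts] .
  then have "finite (arc_perms G ?k)"
    by (rule finite_subset[rotated]) (auto simp: arc_perms_def)
  then have card: "card (arc_perms G ?k) \<noteq> 0" using p0 by auto
  have "coeff (adj_poly G :: 'b poly) (card (pverts G) - ?k) =
    (\<Sum>p\<in>arc_perms G ?k. of_int (sign p) * (-1) ^ ?k)"
    by (rule coeff_adj_poly[OF G k])
  also have "\<dots> = (\<Sum>p\<in>arc_perms G ?k. (-1) ^ card M)"
    by (rule sum.cong) (simp_all add: sign)
  also have "\<dots> \<noteq> 0"
    using card by (simp only: sum_constant minus_one_power_iff)
      (simp add: of_nat_eq_0_iff del: card_eq_0_iff)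
  finally show "coeff (adj_poly G :: 'b poly) (card (pverts G) - ?k) \<noteq> 0" .
qed

text \<open>The order at 0 is at most the index of any nonzero coefficient, here that of
  \<open>x^(n - 2 * card M)\<close>.\<close>

lemma order_0_adj_poly_le:
  assumes "pair_graph G" and "matching G M" and "\<And>C. C \<in> cycles G \<Longrightarrow> 2 * card M < card C"
  shows "Polynomial.order 0 (adj_poly G :: complex poly) + 2 * card M \<le> card (pverts G)"
proof -
  let ?p = "adj_poly G :: complex poly" and ?d = "card (pverts G) - 2 * card M"
  have le: "2 * card M \<le> card (pverts G)"
    by (rule coeff_nonzero_of_matching(1)[OF assms])
  have c: "coeff ?p ?d \<noteq> 0"
    by (rule coeff_nonzero_of_matching(2)[OF assms])
  then have "?p \<noteq> 0" by auto
  have "\<not> monom 1 (Suc ?d) dvd ?p"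
    using c unfolding monom_1_dvd_iff' by blast
  then have "Polynomial.order 0 ?p \<le> ?d"
    unfolding monom_1_dvd_iff[OF \<open>?p \<noteq> 0\<close>] by simp
  with le show ?thesis by simp
qed

lemma matching_subset:
  assumes "matching G N" "M \<subseteq> N"
  shows "matching G M"
  unfolding matching_def
proof (intro conjI ballI impI)
  show "M \<subseteq> edges G"
    using assms by (auto simp: matching_def)
  fix e f assume "e \<in> M" "f \<in> M" "e \<noteq> f"
  then have "e \<in> N" "f \<in> N" using assms(2) by (simp_all add: subsetD)
  then show "e \<inter> f = {}"
    using assms(1) \<open>e \<noteq> f\<close> by (simp add: matching_def)
qed

text \<open>Every second edge of the cycle is taken, starting with the one from
  \<open>ws ! 0\<close> to \<open>ws ! 1\<close>.\<close>

lemma matching_of_even_cycle: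
  assumes G: "pair_graph G" and C: "C \<in> cycles G" "card C = 2 * l"
  obtains M where "matching G M" "card M = l"
proof -
  obtain ws where ws: "3 \<le> length ws" "distinct ws" "set (zip ws (rotate1 ws)) \<subseteq> parcs G"
      "C = (\<lambda>(u, v). {u, v}) ` set (zip ws (rotate1 ws))"
    using C(1) by (auto simp: cycles_iff[OF G])
  have len: "length ws = 2 * l" using card_cycle_edges[OF ws(1,2)] ws(4) C(2) by simp
  let ?e = "\<lambda>i. {ws ! (2 * i), ws ! Suc (2 * i)}"
  have edge: "?e i \<in> edges G" if "i < l" for i
  proof -
    have i: "2 * i < length ws" "Suc (2 * i) < length ws" using that len by auto
    then have "(ws ! (2 * i), ws ! Suc (2 * i)) \<in> set (zip ws (rotate1 ws))"
      by (auto simp: set_zip nth_rotate1 intro!: exI[of _ "2 * i"])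
    then show ?thesis using ws(3) unfolding edges_def by (intro rev_image_eqI) auto
  qed
  have disj: "?e i \<inter> ?e j = {}" if "i < l" "j < l" "i \<noteq> j" for i j
  proof -
    have "2 * i \<noteq> Suc (2 * j)" "Suc (2 * i) \<noteq> 2 * j" by presburger+
    then show ?thesis
      using that ws(2) len by (auto simp: nth_eq_iff_index_eq)
  qed
  have "inj_on ?e {..<l}"
  proof (rule inj_onI, rule ccontr)
    fix i j assume "i \<in> {..<l}" "j \<in> {..<l}" "?e i = ?e j" "i \<noteq> j"
    then show False using disj[of i j] by simp
  qed
  then have "card (?e ` {..<l}) = l" by (simp add: card_image)
  moreover have "matching G (?e ` {..<l})"
    unfolding matching_def
  proof (intro conjI ballI impI)
    show "?e ` {..<l} \<subseteq> edges G" using edge by blast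
    fix e f assume "e \<in> ?e ` {..<l}" "f \<in> ?e ` {..<l}" "e \<noteq> f"
    then obtain i j where "i < l" "j < l" "e = ?e i" "f = ?e j" by auto
    moreover from this \<open>e \<noteq> f\<close> have "i \<noteq> j" by auto
    ultimately show "e \<inter> f = {}" using disj by simp
  qed
  ultimately show ?thesis by (intro that)
qed

section \<open>Disjoint unions, complements, and the polynomial recovered from the spectrum\<close>

lemma pair_graph_union:
  assumes "pair_graph G" "pair_graph H"
  shows "pair_graph (graph_union G H)"
proof -
  interpret G: pair_graph G by (rule assms(1))
  interpret H: pair_graph H by (rule assms(2))
  show ?thesis
  proof
    show "symmetric (with_proj (graph_union G H))"
      using G.pair_sym_arcs H.pair_sym_arcs by (auto simp: symmetric_conv graph_union_def)
  qed (auto simp: graph_union_def G.pair_finite_verts H.pair_finite_verts G.pair_finite_arcs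
      H.pair_finite_arcs dest: G.arc_fst_in_verts G.arc_snd_in_verts H.arc_fst_in_verts
      H.arc_snd_in_verts G.pair_no_loops H.pair_no_loops)
qed

lemma pair_graph_complement:
  assumes "pair_graph G"
  shows "pair_graph (complement G)"
proof -
  interpret G: pair_graph G by (rule assms)
  show ?thesis
  proof
    show "symmetric (with_proj (complement G))"
      using G.pair_sym_arcs by (auto simp: symmetric_conv complement_def)
    show "finite (parcs (complement G))"
      by (rule finite_subset[of _ "pverts G \<times> pverts G"])
        (auto simp: complement_def G.pair_finite_verts)
  qed (auto simp: complement_def G.pair_finite_verts)
qed

text \<open>With the vertices of \<open>G\<close> listed before those of \<open>H\<close>, the
  adjacency matrix of the union is block diagonal.\<close>

lemma adj_poly_graph_union:
  assumes G: "pair_graph G" and H: "pair_graph H" and disj: "pverts G \<inter> pverts H = {}"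
  shows "adj_poly (graph_union G H) = (adj_poly G * adj_poly H :: complex poly)"
proof -
  interpret G: pair_graph G by (rule G)
  interpret H: pair_graph H by (rule H)
  let ?U = "graph_union G H" and ?xs = "vertex_list G" and ?ys = "vertex_list H"
  let ?A = "list_mat ?xs (adj G) :: complex mat" and ?B = "list_mat ?ys (adj H) :: complex mat"
  let ?m = "length ?xs" and ?n = "length ?ys"
  note xs = vertex_list[OF G] and ys = vertex_list[OF H]
  have nth: "?xs ! i \<in> pverts G" if "i < ?m" for i using that xs(2) nth_mem by metis
  have nth': "?ys ! i \<in> pverts H" if "i < ?n" for i using that ys(2) nth_mem by metis
  have adjG: "adj ?U u v = (adj G u v :: complex)" if "u \<in> pverts G" for u v
    using that disj H.in_arcsD1 by (auto simp: adj_def graph_union_def)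
  have adjH: "adj ?U u v = (adj H u v :: complex)" if "u \<in> pverts H" for u v
    using that disj G.in_arcsD1 by (auto simp: adj_def graph_union_def)
  have adj0: "adj G u v = (0 :: complex)" "adj H v u = (0 :: complex)" if "u \<in> pverts G" "v \<in> pverts H" for u v
    using that disj G.in_arcsD2 H.in_arcsD2 by (auto simp: adj_def)
  have "list_mat (?xs @ ?ys) (adj ?U) = four_block_mat ?A (0\<^sub>m ?m ?n) (0\<^sub>m ?n ?m) ?B" (is "?L = ?R")
  proof (rule eq_matI)
    fix i j assume "i < dim_row ?R" "j < dim_col ?R"
    then have ij: "i < ?m + ?n" "j < ?m + ?n" by (simp_all add: list_mat_def)
    then show "?L $$ (i, j) = ?R $$ (i, j)"
      using nth nth' by (auto simp: list_mat_def nth_append adjG adjH adj0)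
  qed (simp_all add: list_mat_def)
  then have "char_poly (list_mat (?xs @ ?ys) (adj ?U) :: complex mat) = char_poly ?A * char_poly ?B"
    using char_poly_factorized[of ?A ?m] char_poly_factorized[of ?B ?n]
    by (intro char_poly_0_block[where n = ?m and m = ?n]) auto
  moreover have "distinct (?xs @ ?ys)" "set (?xs @ ?ys) = pverts ?U"
    using xs ys disj by (auto simp: graph_union_def)
  ultimately have "adj_poly ?U = char_poly ?A * char_poly ?B"
    using adj_poly_eq_list_mat[OF pair_graph_union[OF G H]] by metis
  also have "char_poly ?A = adj_poly G"
    by (rule adj_poly_eq_list_mat[OF G xs(1,2), symmetric])
  also have "char_poly ?B = adj_poly H"
    by (rule adj_poly_eq_list_mat[OF H ys(1,2), symmetric])
  finally show ?thesis .
qed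

text \<open>A monic complex polynomial is the product of its linear factors, so graphs with equal
  spectra have equal \<open>adj_poly\<close>.\<close>

lemma adj_poly_eq_prod_spectrum:
  assumes "pair_graph G"
  shows "adj_poly G = (\<Prod>x\<in>#adj_spectrum G. [:- x, 1:])"
proof -
  have "(adj_matrix G :: complex mat) \<in> carrier_mat (card (pverts G)) (card (pverts G))"
    by (simp add: adj_matrix_def)
  from degree_monic_char_poly[OF this] have "lead_coeff (adj_poly G :: complex poly) = 1"
    by (simp add: adj_poly_def)
  then show ?thesis
    using complex_poly_decompose_multiset[of "adj_poly G"] by (simp add: adj_spectrum_def)
qed

subsection \<open>Common neighbours\<close>

text \<open>This is an entry of the square of the adjacency matrix; for \<open>u = w\<close> it is
  the degree of \<open>u\<close>.\<close>

definition common_neighbours :: "'a pair_pre_digraph \<Rightarrow> 'a \<Rightarrow> 'a \<Rightarrow> int" where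
  "common_neighbours G u w = (\<Sum>v\<in>pverts G. adj G u v * adj G v w)"

lemma adj_commute: "pair_graph G \<Longrightarrow> adj G u v = adj G v u"
proof -
  assume "pair_graph G"
  then interpret pair_graph G .
  show ?thesis using pair_sym_arcs by (auto simp: adj_def symmetric_conv)
qed

lemma parcs_sym: "pair_graph G \<Longrightarrow> (u, v) \<in> parcs G \<Longrightarrow> (v, u) \<in> parcs G"
  using adj_commute[of G u v] by (auto simp: adj_def split: if_splits)

lemma of_int_adj: "of_int (adj G u v) = adj G u v"
  by (simp add: adj_def)

lemma adj_idem: "adj G u v * adj G u v = adj G u v"
  by (simp add: adj_def)

lemma adj_irrefl: "pair_graph G \<Longrightarrow> adj G v v = 0"
proof -
  assume "pair_graph G"
  then interpret pair_graph G .
  show ?thesis using pair_no_loops[of "(v, v)"] by (auto simp: adj_def)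
qed

text \<open>The traces of powers are written as images of integers, so that equal complex spectra
  yield equations between integers.\<close>

lemma adj_spectrum_power_sums:
  assumes G: "pair_graph G"
  defines "V \<equiv> pverts G"
  shows "size (adj_spectrum G) = card V"
    and "(\<Sum>e\<in>#adj_spectrum G. e ^ 2) = of_int (\<Sum>u\<in>V. \<Sum>v\<in>V. adj G u v)"
    and "(\<Sum>e\<in>#adj_spectrum G. e ^ 3) =
      of_int (\<Sum>u\<in>V. \<Sum>w\<in>V. common_neighbours G u w * adj G w u)"
    and "(\<Sum>e\<in>#adj_spectrum G. e ^ 4) = of_int (\<Sum>u\<in>V. \<Sum>w\<in>V. (common_neighbours G u w)\<^sup>2)"
proof -
  have eq: "adj_spectrum G = proots (char_poly (list_mat (vertex_list G) (adj G)))"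
    by (simp add: adj_spectrum_def adj_poly_def adj_matrix_eq_list_mat[OF G])
  have V: "V = set (vertex_list G)" using vertex_list[OF G] by (simp add: V_def)
  note p = power_sum_list_mat[OF vertex_list(1)[OF G] V, of "adj G", folded eq]
  have N: "(\<Sum>v\<in>V. adj G u v * adj G v w) = (of_int (common_neighbours G u w) :: complex)" for u w
    by (simp add: common_neighbours_def V_def of_int_adj)
  have comm: "common_neighbours G w u = common_neighbours G u w" for u w
    unfolding common_neighbours_def by (rule sum.cong[OF refl]) (metis adj_commute[OF G] mult.commute)
  show "size (adj_spectrum G) = card V" by (rule p(1))
  have idem: "adj G u v * adj G v u = (adj G u v :: complex)" for u v
    using adj_idem adj_commute[OF G] by metis
  show "(\<Sum>e\<in>#adj_spectrum G. e ^ 2) = of_int (\<Sum>u\<in>V. \<Sum>v\<in>V. adj G u v)"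
    unfolding p(2) idem by (simp add: of_int_adj)
  show "(\<Sum>e\<in>#adj_spectrum G. e ^ 3) =
      of_int (\<Sum>u\<in>V. \<Sum>w\<in>V. common_neighbours G u w * adj G w u)"
    unfolding p(3) N by (simp add: of_int_adj)
  show "(\<Sum>e\<in>#adj_spectrum G. e ^ 4) = of_int (\<Sum>u\<in>V. \<Sum>w\<in>V. (common_neighbours G u w)\<^sup>2)"
    unfolding p(4) N by (simp add: comm power2_eq_square)
qed

text \<open>The other quantities in this formula are determined by the spectrum of \<open>G\<close>,
  so the spectrum of the complement yields the sum of all
  \<open>common_neighbours G u w\<close>.\<close>

lemma power_sum_3_complement:
  assumes G: "pair_graph G"
  defines "V \<equiv> pverts G"
  defines "n \<equiv> int (card V)" and "s \<equiv> (\<Sum>u\<in>V. \<Sum>v\<in>V. adj G u v)"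
  shows "(\<Sum>e\<in>#adj_spectrum (complement G). e ^ 3) =
    of_int (n ^ 3 - 3 * n * (n + s) +
      3 * (n + 2 * s + (\<Sum>u\<in>V. \<Sum>w\<in>V. common_neighbours G u w)) -
      (n + 3 * s + (\<Sum>u\<in>V. \<Sum>w\<in>V. common_neighbours G u w * adj G w u)))"
proof -
  interpret pair_graph G by (rule G)
  have V: "pverts (complement G) = V" by (simp add: complement_def V_def)
  have c: "adj (complement G) u v = (if u = v then 0 else 1 - adj G u v :: int)"
    if "u \<in> V" "v \<in> V" for u v
    using that by (simp add: adj_def complement_def V_def)
  have idem: "adj G u v * adj G v u = (adj G u v :: int)" for u v
    using adj_idem adj_commute[OF G] by metis
  have fin: "finite V" using pair_finite_verts by (simp add: V_def)
  have "(\<Sum>e\<in>#adj_spectrum (complement G). e ^ 3) = of_int (\<Sum>u\<in>V. \<Sum>w\<in>V.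
      (\<Sum>v\<in>V. adj (complement G) u v * adj (complement G) v w) * adj (complement G) w u)"
    using adj_spectrum_power_sums(3)[OF pair_graph_complement[OF G]]
    by (simp add: common_neighbours_def V)
  also have "(\<Sum>u\<in>V. \<Sum>w\<in>V.
      (\<Sum>v\<in>V. adj (complement G) u v * adj (complement G) v w) * adj (complement G) w u) =
    n ^ 3 - 3 * n * (n + s) + 3 * (n + 2 * s + (\<Sum>u\<in>V. \<Sum>w\<in>V. common_neighbours G u w)) -
      (n + 3 * s + (\<Sum>u\<in>V. \<Sum>w\<in>V. common_neighbours G u w * adj G w u))"
    using sum_triple_product_complement[OF fin adj_irrefl[OF G] c]
    by (simp add: n_def s_def common_neighbours_def idem flip: V_def)
  finally show ?thesis .
qed

text \<open>This is eight times the number of 4-cycles: each arises from four ordered pairs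
  \<open>u\<close>, \<open>w\<close> of opposite vertices and two orders of the remaining
  vertices.\<close>

definition common_neighbour_excess :: "'a pair_pre_digraph \<Rightarrow> int" where
  "common_neighbour_excess G = (\<Sum>u\<in>pverts G. \<Sum>w\<in>pverts G - {u}.
     common_neighbours G u w * (common_neighbours G u w - 1))"

text \<open>From the sum over all pairs one subtracts the diagonal terms
  \<open>d u * (d u - 1)\<close>, with \<open>d u\<close> the degree. The sum of
  \<open>d u * d u\<close> equals the sum of all common neighbour counts, whence the factor
  2.\<close>

lemma common_neighbour_excess_eq:
  assumes G: "pair_graph G"
  defines "V \<equiv> pverts G"
  shows "common_neighbour_excess G = (\<Sum>u\<in>V. \<Sum>w\<in>V. (common_neighbours G u w)\<^sup>2)
    - 2 * (\<Sum>u\<in>V. \<Sum>w\<in>V. common_neighbours G u w) + (\<Sum>u\<in>V. \<Sum>v\<in>V. adj G u v)"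
proof -
  interpret pair_graph G by (rule G)
  let ?N = "common_neighbours G"
  define d where "d u = (\<Sum>v\<in>V. adj G u v :: int)" for u
  have fin: "finite V" using pair_finite_verts by (simp add: V_def)
  have diag: "?N u u = d u" for u
    unfolding common_neighbours_def d_def V_def
    by (rule sum.cong[OF refl]) (metis adj_idem adj_commute[OF G])
  have d': "(\<Sum>u\<in>V. adj G u v) = d v" for v
    unfolding d_def by (rule sum.cong[OF refl]) (rule adj_commute[OF G])
  have "(\<Sum>u\<in>V. \<Sum>w\<in>V. ?N u w) = (\<Sum>u\<in>V. \<Sum>v\<in>V. \<Sum>w\<in>V. adj G u v * adj G v w)"
    unfolding common_neighbours_def V_def by (rule sum.cong[OF refl], rule sum.swap)
  also have "\<dots> = (\<Sum>v\<in>V. \<Sum>u\<in>V. adj G u v * d v)"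
    unfolding d_def by (subst sum.swap) (simp add: sum_distrib_left)
  also have "\<dots> = (\<Sum>v\<in>V. d v * d v)"
    by (simp add: d' flip: sum_distrib_right)
  finally have W: "(\<Sum>u\<in>V. \<Sum>w\<in>V. ?N u w) = (\<Sum>v\<in>V. d v * d v)" .
  have "common_neighbour_excess G =
    (\<Sum>u\<in>V. (\<Sum>w\<in>V. ?N u w * (?N u w - 1)) - ?N u u * (?N u u - 1))"
    unfolding common_neighbour_excess_def V_def[symmetric] using fin
    by (intro sum.cong[OF refl]) (simp add: sum_diff1)
  also have "\<dots> = (\<Sum>u\<in>V. \<Sum>w\<in>V. (?N u w)\<^sup>2) - (\<Sum>u\<in>V. \<Sum>w\<in>V. ?N u w)
      - ((\<Sum>u\<in>V. d u * d u) - (\<Sum>u\<in>V. d u))"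
    by (simp add: diag sum_subtractf power2_eq_square algebra_simps)
  finally show ?thesis unfolding W d_def by simp
qed

lemma common_neighbour_excess_cospectral:
  assumes G: "pair_graph G" and H: "pair_graph H" and cosp: "generalized_cospectral G H"
  shows "common_neighbour_excess G = common_neighbour_excess H"
proof -
  have sp: "adj_spectrum G = adj_spectrum H"
    "adj_spectrum (complement G) = adj_spectrum (complement H)"
    using cosp by (auto simp: generalized_cospectral_def)
  note pG = adj_spectrum_power_sums[OF G] and pH = adj_spectrum_power_sums[OF H]
  note cG = power_sum_3_complement[OF G] and cH = power_sum_3_complement[OF H]
  have n: "card (pverts G) = card (pverts H)"
    using pG(1) pH(1) sp(1) by simp
  have s: "(\<Sum>u\<in>pverts G. \<Sum>v\<in>pverts G. adj G u v) = (\<Sum>u\<in>pverts H. \<Sum>v\<in>pverts H. adj H u v :: int)"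
    using trans[OF pG(2)[unfolded sp(1), symmetric] pH(2)] unfolding of_int_eq_iff .
  have t: "(\<Sum>u\<in>pverts G. \<Sum>w\<in>pverts G. common_neighbours G u w * adj G w u) =
      (\<Sum>u\<in>pverts H. \<Sum>w\<in>pverts H. common_neighbours H u w * adj H w u)"
    using trans[OF pG(3)[unfolded sp(1), symmetric] pH(3)] unfolding of_int_eq_iff .
  have q: "(\<Sum>u\<in>pverts G. \<Sum>w\<in>pverts G. (common_neighbours G u w)\<^sup>2) =
      (\<Sum>u\<in>pverts H. \<Sum>w\<in>pverts H. (common_neighbours H u w)\<^sup>2)"
    using trans[OF pG(4)[unfolded sp(1), symmetric] pH(4)] unfolding of_int_eq_iff .
  \<comment> \<open>Once \<open>n\<close>, \<open>s\<close> and \<open>t\<close> are identified, the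
    formulas for the complements differ only in three times this sum.\<close>
  have "(\<Sum>u\<in>pverts G. \<Sum>w\<in>pverts G. common_neighbours G u w) =
      (\<Sum>u\<in>pverts H. \<Sum>w\<in>pverts H. common_neighbours H u w)"
    using trans[OF cG[symmetric] trans[OF arg_cong[OF sp(2), of "\<lambda>S. \<Sum>e\<in>#S. e ^ 3"] cH]]
    unfolding of_int_eq_iff n s t by simp
  then show ?thesis
    unfolding common_neighbour_excess_eq[OF G] common_neighbour_excess_eq[OF H] s q by simp
qed

lemma common_neighbours_eq_card:
  assumes "pair_graph G"
  shows "common_neighbours G u w = int (card {v. (u, v) \<in> parcs G \<and> (v, w) \<in> parcs G})"
proof -
  interpret pair_graph G by (rule assms)
  have "common_neighbours G u w = (\<Sum>v\<in>pverts G. if (u, v) \<in> parcs G \<and> (v, w) \<in> parcs G then 1 else 0)"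
    unfolding common_neighbours_def by (rule sum.cong) (simp_all add: adj_def)
  also have "\<dots> = int (card {v \<in> pverts G. (u, v) \<in> parcs G \<and> (v, w) \<in> parcs G})"
    using pair_finite_verts by (simp add: sum.inter_filter[symmetric])
  also have "{v \<in> pverts G. (u, v) \<in> parcs G \<and> (v, w) \<in> parcs G} =
      {v. (u, v) \<in> parcs G \<and> (v, w) \<in> parcs G}"
    using in_arcsD1 by blast
  finally show ?thesis .
qed

text \<open>Two common neighbours of distinct vertices would close a 4-cycle, so each count is 0 or
  1 and its term vanishes.\<close>

lemma common_neighbour_excess_acyclic:
  assumes G: "pair_graph G" and acyclic: "cycles G = {}"
  shows "common_neighbour_excess G = 0"
  unfolding common_neighbour_excess_def
proof (intro sum.neutral ballI)
  interpret pair_graph G by (rule G)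
  fix u w assume "u \<in> pverts G" "w \<in> pverts G - {u}"
  then have "u \<noteq> w" by auto
  let ?S = "{v. (u, v) \<in> parcs G \<and> (v, w) \<in> parcs G}"
  have "x = y" if x: "x \<in> ?S" and y: "y \<in> ?S" for x y
  proof (rule ccontr)
    assume "x \<noteq> y"
    moreover have "(w, y) \<in> parcs G" "(y, u) \<in> parcs G"
      using y by (auto intro: parcs_sym[OF G])
    ultimately show False
      using cycle_of_two_common_neighbours[OF G \<open>u \<noteq> w\<close>] x acyclic by blast
  qed
  then have "card ?S \<le> 1"
    by (metis (no_types, lifting) card_le_Suc0_iff_eq One_nat_def card.infinite zero_le)
  then show "common_neighbours G u w * (common_neighbours G u w - 1) = 0"
    unfolding common_neighbours_eq_card[OF G] by (cases "card ?S") auto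
qed

text \<open>Opposite vertices of the 4-cycle have at least two common neighbours and give a positive
  term; no term is negative, the counts being natural numbers.\<close>

lemma common_neighbour_excess_4_cycle:
  assumes G: "pair_graph G" and C: "C \<in> cycles G" "card C = 4"
  shows "common_neighbour_excess G > 0"
proof -
  interpret pair_graph G by (rule G)
  let ?N = "common_neighbours G"
  let ?f = "\<lambda>u w. ?N u w * (?N u w - 1)"
  have nonneg: "0 \<le> ?f u w" for u w
    unfolding common_neighbours_eq_card[OF G]
    by (cases "card {v. (u, v) \<in> parcs G \<and> (v, w) \<in> parcs G}") auto
  obtain u x w y where uw: "u \<noteq> w" "x \<noteq> y" "(u, x) \<in> parcs G" "(x, w) \<in> parcs G"
      "(w, y) \<in> parcs G" "(y, u) \<in> parcs G"
    by (rule cycle_of_card_4[OF G C])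
  have "(u, y) \<in> parcs G" "(y, w) \<in> parcs G"
    by (rule parcs_sym[OF G uw(6)], rule parcs_sym[OF G uw(5)])
  then have "{x, y} \<subseteq> {v. (u, v) \<in> parcs G \<and> (v, w) \<in> parcs G}"
    using uw by auto
  moreover have "finite {v. (u, v) \<in> parcs G \<and> (v, w) \<in> parcs G}"
    by (rule finite_subset[OF _ pair_finite_verts]) (auto dest: in_arcsD1)
  ultimately have "card {x, y} \<le> card {v. (u, v) \<in> parcs G \<and> (v, w) \<in> parcs G}"
    by (intro card_mono)
  then have "2 \<le> ?N u w"
    using uw(2) by (simp add: common_neighbours_eq_card[OF G])
  then have pos: "0 < ?f u w" by simp
  have V: "u \<in> pverts G" "w \<in> pverts G - {u}"
    using uw in_arcsD1 in_arcsD2 by auto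
  have "0 < (\<Sum>w\<in>pverts G - {u}. ?f u w)"
    using pair_finite_verts V(2) pos nonneg by (intro sum_pos2[of _ w]) auto
  then show ?thesis
    unfolding common_neighbour_excess_def
    by (intro sum_pos2[OF pair_finite_verts V(1)] sum_nonneg nonneg)
qed

section \<open>Comparison of the tree \<open>T\<close> with the components \<open>R\<close> and
  \<open>U\<close>\<close>

theorem corollary4p8:
  fixes T :: "'a pair_pre_digraph"
    and H R U :: "'b pair_pre_digraph"
    and C :: "'b set set"
    and l :: nat
  assumes "pair_graph T" and "tree_graph T" and "main_factor_multiplicity T = 2"
    and "H = graph_union R U" and "pverts R \<inter> pverts U = {}"
    and "\<not> connected_graph H" and "generalized_cospectral H T"
    and "pair_graph R" and "tree_graph R"
    and "pair_graph U" and "unicyclic U" and "bipartite U"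
    and "C \<in> cycles U" and "card C = 2 * l"
  shows "int (matching_number T) - int (matching_number R) \<ge> int l - 1
    \<and> int l - 1 \<ge> 2
    \<and> int (matching_number R) \<le> int (matching_number T) - 2"
proof -
  note G = assms(1,8,10) and disj = assms(5)
  have T: "cycles T = {}" and R: "cycles R = {}"
    using assms(2,9) by (simp_all add: tree_graph_def)
  have U: "C' = C" if "C' \<in> cycles U" for C'
    using assms(11,13) that by (auto simp: unicyclic_def)
  have H: "pair_graph H"
    unfolding assms(4) by (rule pair_graph_union[OF G(2,3)])
  have spec: "adj_spectrum H = adj_spectrum T"
    using assms(7) by (simp add: generalized_cospectral_def)

  \<comment> \<open>The cycle length is even and at least 3, so \<open>l \<ge> 2\<close>, and only
    \<open>l = 2\<close> remains to be excluded.\<close>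
  have "3 \<le> 2 * l"
    using card_cycle_ge_3[OF G(3) assms(13)] assms(14) by simp
  moreover have "l \<noteq> 2"
  proof
    assume "l = 2"
    have "parcs U \<subseteq> parcs H" by (simp add: assms(4) graph_union_def)
    then have "C \<in> cycles H"
      using assms(13) unfolding cycles_iff[OF G(3)] cycles_iff[OF H] by blast
    then have "common_neighbour_excess H > 0"
      using common_neighbour_excess_4_cycle[OF H] assms(14) \<open>l = 2\<close> by simp
    moreover have "common_neighbour_excess H = 0"
      using common_neighbour_excess_cospectral[OF H G(1) assms(7)]
        common_neighbour_excess_acyclic[OF G(1) T] by simp
    ultimately show False by simp
  qed
  ultimately have l: "3 \<le> l" by simp

  let ?pT = "adj_poly T :: complex poly" and ?pR = "adj_poly R :: complex poly"
    and ?pU = "adj_poly U :: complex poly"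
  have "?pT = adj_poly H"
    using adj_poly_eq_prod_spectrum[OF H] adj_poly_eq_prod_spectrum[OF G(1)] spec by simp
  also have "\<dots> = ?pR * ?pU"
    unfolding assms(4) by (rule adj_poly_graph_union[OF G(2,3) disj])
  finally have pT: "?pT = ?pR * ?pU" .
  have nz: "?pT \<noteq> 0"
    unfolding adj_poly_eq_prod_spectrum[OF G(1)] by (auto simp: prod_mset_zero_iff)
  then have ord: "Polynomial.order 0 ?pT = Polynomial.order 0 ?pR + Polynomial.order 0 ?pU"
    unfolding pT by (rule order_mult)
  have "card (pverts T) = card (pverts H)"
    using adj_spectrum_power_sums(1)[OF G(1)] adj_spectrum_power_sums(1)[OF H] spec by simp
  also have "\<dots> = card (pverts R) + card (pverts U)"
    using disj pair_fin_digraph.pair_finite_verts[of R] pair_fin_digraph.pair_finite_verts[of U] G(2,3)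
    by (simp add: assms(4) graph_union_def card_Un_disjoint pair_graph_def pair_digraph_def)
  finally have n: "card (pverts T) = card (pverts R) + card (pverts U)" .

  \<comment> \<open>The order at 0 is the least index of a nonzero coefficient; it serves as
    \<open>i\<close> in the bound for forests.\<close>
  have "coeff ?pT (Polynomial.order 0 ?pT) \<noteq> 0"
    using monom_1_dvd_iff[OF nz, of "Polynomial.order 0 ?pT"]
      monom_1_dvd_iff[OF nz, of "Suc (Polynomial.order 0 ?pT)"]
    unfolding monom_1_dvd_iff' by (auto simp: less_Suc_eq)
  then have nuT: "card (pverts T) \<le> Polynomial.order 0 ?pT + 2 * matching_number T"
    by (rule forest_coeff_nonzero[OF G(1) T])
  obtain M where "matching R M" "card M = matching_number R"
    using matching_number_attained[OF G(2)] .
  \<comment> \<open>\<open>R\<close> has no cycles, so the condition on cycle lengths is vacuous and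
    a maximum matching is admissible.\<close>
  then have nuR: "Polynomial.order 0 ?pR + 2 * matching_number R \<le> card (pverts R)"
    using order_0_adj_poly_le[OF G(2), of M] R by simp
  obtain N where N: "matching U N" "card N = l"
    using matching_of_even_cycle[OF G(3) assms(13,14)] .
  \<comment> \<open>One edge is dropped so that \<open>2 * card M'\<close> stays below the length of
    \<open>C\<close>. With \<open>l\<close> edges, the two orientations of \<open>C\<close> would
    enter with sign \<open>-1\<close> against \<open>(-1)^l\<close> for matchings, and terms could
    cancel for even \<open>l\<close>.\<close>
  obtain M' where M': "M' \<subseteq> N" "card M' = l - 1"
    using N(2) obtain_subset_with_card_n[of "l - 1" N] by auto
  have "matching U M'"
    using N(1) M'(1) by (rule matching_subset)
  moreover have "2 * card M' < card C'" if C': "C' \<in> cycles U" for C'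
  proof -
    have "card C' = 2 * l" unfolding U[OF C'] by (rule assms(14))
    then show ?thesis using l M'(2) by linarith
  qed
  ultimately have "Polynomial.order 0 ?pU + 2 * card M' \<le> card (pverts U)"
    by (rule order_0_adj_poly_le[OF G(3)])
  then have nuU: "Polynomial.order 0 ?pU + 2 * (l - 1) \<le> card (pverts U)"
    by (simp only: M'(2))
  \<comment> \<open>Eliminating the three orders leaves twice this inequality, stated with sums to
    avoid truncated subtraction.\<close>
  have "matching_number R + l \<le> matching_number T + 1"
    using nuT nuR nuU ord n l by linarith
  then show ?thesis using l by linarith
qed

end
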